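(* A linear space $U\subset\mathbb{R}^V$ of graph signals is shift-invariant if and only if there exists a graph range function $J$ such that $$U=\{\mathbf{x}\in\mathbb{R}^V\ :\ \widehat{\mathbf{x}}(m)\in J(\boldsymbol{\gamma}(m)),\ 1\le m\le M\}.$$
   Context: Let $\mathcal{G}=(V,E,\mathbf{W})$ be a finite, simple, undirected graph with $N\ge 2$ vertices. A graph signal is a vector in $\mathbb{R}^V$. A graph shift is a matrix $\mathbf{S}=[s(i,j)]_{i,j\in V}$ with $s(i,j)=0$ unless $i=j$ or $(i,j)\in E$. Standing assumption: $\mathbf{S}_1,\ldots,\mathbf{S}_d$ are graph shifts that are real-valued, symmetric and pairwise commuting. Choose an orthogonal matrix $\mathbf{U}=[\mathbf{u}_1,\ldots,\mathbf{u}_N]$ with $\mathbf{S}_l=\sum_{n=1}^N\lambda_l(n)\mathbf{u}_n\mathbf{u}_n^T$ for $1\le l\le d$, and set $\boldsymbol{\lambda}(n)=[\lambda_1(n),\ldots,\lambda_d(n)]^T\in\mathbb{R}^d$. Let $\boldsymbol{\gamma}(m)=[\gamma_1(m),\ldots,\gamma_d(m)]^T$, $1\le m\le M$, be the distinct elements of $\{\boldsymbol{\lambda}(n): 1\le n\le N\}$. Put $\mathbf{P}_m=\sum_{\boldsymbol{\lambda}(n)=\boldsymbol{\gamma}(m)}\mathbf{u}_n\mathbf{u}_n^T$ (the orthogonal projection onto $\bigcap_{l=1}^d\ker(\mathbf{S}_l-\gamma_l(m)\mathbf{I})$, independent of the choice of $\mathbf{U}$). The graph Fourier transform of $\mathbf{x}\in\mathbb{R}^V$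 has components $\widehat{\mathbf{x}}(m)=\mathbf{P}_m\mathbf{x}$, $1\le m\le M$. A linear space $U$ of graph signals is shift-invariant if $\mathbf{S}_l\mathbf{x}\in U$ for all $1\le l\le d$ and $\mathbf{x}\in U$. A graph range function is a map $J$ assigning to every $\boldsymbol{\gamma}(m)$, $1\le m\le M$, a linear subspace $J(\boldsymbol{\gamma}(m))$ of $\mathbb{R}^V$. *)

theory Defs
  imports "HOL-Analysis.Analysis"
begin

text \<open>
  The vertex set is the whole finite type \<open>'n\<close>, the index set of the shifts is the (nonempty)
  finite type \<open>'d\<close>. A graph signal has type \<open>real^'n\<close>. The edge weights are not used by any
  notion below, so a graph is given by its edge relation only.
\<close>

definition simple_graph :: "('n::finite \<times> 'n) set \<Rightarrow> bool" where
  "simple_graph E \<longleftrightarrow> sym E \<and> irrefl E"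

definition graph_shift :: "('n::finite \<times> 'n) set \<Rightarrow> real^'n^'n \<Rightarrow> bool" where
  "graph_shift E A \<longleftrightarrow> (\<forall>i j. i \<noteq> j \<and> (i, j) \<notin> E \<longrightarrow> A $ i $ j = 0)"

definition commuting_shifts ::
    "('n::finite \<times> 'n) set \<Rightarrow> ('d::finite \<Rightarrow> real^'n^'n) \<Rightarrow> bool" where
  "commuting_shifts E S \<longleftrightarrow>
     (\<forall>l. graph_shift E (S l) \<and> transpose (S l) = S l) \<and> (\<forall>k l. S k ** S l = S l ** S k)"

text \<open>The matrix \<open>u u\<^sup>T\<close>.\<close>
definition outer_self :: "real^'n::finite \<Rightarrow> real^'n^'n" where
  "outer_self u = (columnvector u :: real^1^'n) ** (rowvector u :: real^'n^1)"

text \<open>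
  \<open>Q\<close> has the columns \<open>u\<^sub>n\<close>; these are indexed by \<open>'n\<close> itself, which has as many elements as
  there are vertices. The vector \<open>lam n\<close> is \<open>(\<lambda>\<^sub>1(n), \<dots>, \<lambda>\<^sub>d(n))\<close>.
\<close>
definition joint_diagonalization ::
    "('d::finite \<Rightarrow> real^'n::finite^'n) \<Rightarrow> real^'n^'n \<Rightarrow> ('n \<Rightarrow> real^'d) \<Rightarrow> bool" where
  "joint_diagonalization S Q lam \<longleftrightarrow>
     orthogonal_matrix Q \<and>
     (\<forall>l. S l = (\<Sum>n\<in>UNIV. (lam n $ l) *\<^sub>R outer_self (column n Q)))"

definition spectral_projection ::
    "real^'n::finite^'n \<Rightarrow> ('n \<Rightarrow> real^'d::finite) \<Rightarrow> real^'d \<Rightarrow> real^'n^'n" where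
  "spectral_projection Q lam g = (\<Sum>n | lam n = g. outer_self (column n Q))"

text \<open>The component \<open>m\<close> of the graph Fourier transform of \<open>x\<close>, where \<open>\<gamma>\<close> enumerates the joint
  spectrum.\<close>
definition graph_fourier ::
    "real^'n::finite^'n \<Rightarrow> ('n \<Rightarrow> real^'d::finite) \<Rightarrow> (nat \<Rightarrow> real^'d) \<Rightarrow> real^'n \<Rightarrow> nat \<Rightarrow> real^'n" where
  "graph_fourier Q lam \<gamma> x m = spectral_projection Q lam (\<gamma> m) *v x"

definition shift_invariant ::
    "('d::finite \<Rightarrow> real^'n::finite^'n) \<Rightarrow> (real^'n) set \<Rightarrow> bool" where
  "shift_invariant S U \<longleftrightarrow> (\<forall>l. \<forall>x\<in>U. S l *v x \<in> U)"

text \<open>Only the values of \<open>J\<close> on the joint spectrum \<open>{\<gamma> 1, \<dots>, \<gamma> M}\<close> are constrained.\<close>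
definition graph_range_function ::
    "nat \<Rightarrow> (nat \<Rightarrow> real^'d::finite) \<Rightarrow> (real^'d \<Rightarrow> (real^'n::finite) set) \<Rightarrow> bool" where
  "graph_range_function M \<gamma> J \<longleftrightarrow> (\<forall>m\<in>{1..M}. subspace (J (\<gamma> m)))"

end

theory Submission
  imports Defs
begin

text \<open>
  Each spectral projection turns a shift \<open>S\<^sub>l\<close> into multiplication by the \<open>l\<close>-th coordinate of
  the joint eigenvalue, so every set defined by a range function is shift-invariant. Conversely, an
  invariant subspace is stable under every spectral projection: for distinct joint eigenvalues \<open>g\<close>
  and \<open>h\<close>, differing in coordinate \<open>l\<close>, the map \<open>(S\<^sub>l - h\<^sub>l) / (g\<^sub>l - h\<^sub>l)\<close> annihilates the
  component at \<open>h\<close> and fixes the component at \<open>g\<close>, and composing these maps over all \<open>h\<close> isolates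
  the component at \<open>g\<close>. The range function \<open>J(g) = P\<^sub>g U\<close> then recovers \<open>U\<close>.
\<close>

lemma outer_self_mult_vec: "outer_self u *v x = (u \<bullet> x) *\<^sub>R u"
  by (simp add: vec_eq_iff outer_self_def matrix_vector_mult_def matrix_matrix_mult_def
      columnvector_def rowvector_def inner_vec_def sum_distrib_right sum_distrib_left mult_ac)

lemma sum_matrix_vector_mult:
  fixes A :: "'a \<Rightarrow> real^'n^'m"
  shows "(\<Sum>i\<in>I. A i) *v x = (\<Sum>i\<in>I. A i *v x)"
  by (induction I rule: infinite_finite_induct) (auto simp: matrix_vector_mult_add_rdistrib)

lemma spectral_projection_mult_vec:
  "spectral_projection Q lam g *v x = (\<Sum>n | lam n = g. (column n Q \<bullet> x) *\<^sub>R column n Q)"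
  by (simp add: spectral_projection_def sum_matrix_vector_mult outer_self_mult_vec)

text \<open>Since \<open>Q ** transpose Q\<close> is the identity, \<open>x\<close> is
  \<open>Q\<close> applied to its vector of coefficients in the orthonormal basis of
  columns.\<close>

lemma orthogonal_matrix_expansion:
  fixes Q :: "real^'n^'n"
  assumes "orthogonal_matrix Q"
  shows "(\<Sum>n\<in>UNIV. (column n Q \<bullet> x) *\<^sub>R column n Q) = x"
proof -
  have "x = Q *v (transpose Q *v x)"
    using assms by (simp add: matrix_vector_mul_assoc orthogonal_matrix_def
        del: transpose_matrix_vector)
  also have "transpose Q *v x = (\<chi> n. column n Q \<bullet> x)"
    by (simp add: vec_eq_iff matrix_vector_mult_def transpose_def column_def inner_vec_def
        del: transpose_matrix_vector)
  also have "Q *v \<dots> = (\<Sum>n\<in>UNIV. (column n Q \<bullet> x) *\<^sub>R column n Q)"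
    by (simp add: matrix_mult_sum scalar_mult_eq_scaleR)
  finally show ?thesis by simp
qed

text \<open>Grouping the column expansion of \<open>x\<close> by the fibres of \<open>lam\<close>
  gives one spectral component per joint eigenvalue.\<close>

lemma sum_spectral_projection:
  assumes "orthogonal_matrix Q"
  shows "(\<Sum>g\<in>range lam. spectral_projection Q lam g *v x) = x"
proof -
  have "(\<Sum>g\<in>range lam. spectral_projection Q lam g *v x)
      = (\<Sum>n\<in>UNIV. (column n Q \<bullet> x) *\<^sub>R column n Q)"
    using sum.image_gen[of UNIV "\<lambda>n. (column n Q \<bullet> x) *\<^sub>R column n Q" lam]
    by (simp add: spectral_projection_mult_vec)
  with assms show ?thesis by (simp add: orthogonal_matrix_expansion)
qed

lemma column_inner_shift:
  assumes "joint_diagonalization S Q lam"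
  shows "column n Q \<bullet> (S l *v x) = lam n $ l * (column n Q \<bullet> x)"
proof -
  have Q: "orthogonal_matrix Q" and S: "S l = (\<Sum>k\<in>UNIV. (lam k $ l) *\<^sub>R outer_self (column k Q))"
    using assms by (auto simp: joint_diagonalization_def)
  have orth: "column n Q \<bullet> column k Q = (if k = n then 1 else 0)" for k
    using Q orthogonal_matrix_orthonormal_columns[of Q]
    by (auto simp: orthogonal_def norm_eq_1)
  have "S l *v x = (\<Sum>k\<in>UNIV. (lam k $ l * (column k Q \<bullet> x)) *\<^sub>R column k Q)"
    by (simp add: S sum_matrix_vector_mult outer_self_mult_vec flip: scaleR_matrix_vector_assoc)
  then show ?thesis by (simp add: inner_sum_right orth if_distrib cong: if_cong)
qed

text \<open>Only columns with \<open>lam n = g\<close> contribute, and the shift multiplies each of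
  their coefficients by the same number \<open>g $ l\<close>.\<close>

lemma spectral_projection_shift:
  assumes "joint_diagonalization S Q lam"
  shows "spectral_projection Q lam g *v (S l *v x) = (g $ l) *\<^sub>R (spectral_projection Q lam g *v x)"
  by (auto simp: spectral_projection_mult_vec column_inner_shift[OF assms] scaleR_sum_right
      intro!: sum.cong)

lemma shift_invariant_annihilate_components:
  assumes diag: "joint_diagonalization S Q lam" and inv: "shift_invariant S U"
    and U: "subspace U" and "x \<in> U" and "finite A" and "g \<notin> A"
  shows "\<exists>y\<in>U. spectral_projection Q lam g *v y = spectral_projection Q lam g *v x \<and>
    (\<forall>h\<in>A. spectral_projection Q lam h *v y = 0)"
  using \<open>finite A\<close> \<open>g \<notin> A\<close>
proof (induction A rule: finite_induct)
  case empty
  with \<open>x \<in> U\<close> show ?case by blast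
next
  case (insert h A)
  let ?P = "spectral_projection Q lam"
  obtain y where y: "y \<in> U" "?P g *v y = ?P g *v x" "\<forall>k\<in>A. ?P k *v y = 0"
    using insert by auto
  obtain l where l: "g $ l \<noteq> h $ l"
    using insert.prems by (auto simp: vec_eq_iff)
  define z where "z = (1 / (g $ l - h $ l)) *\<^sub>R (S l *v y - (h $ l) *\<^sub>R y)"
  \<comment> \<open>The factor is 1 at \<open>k = g\<close> and 0 at \<open>k = h\<close>; for
    \<open>k\<close> in \<open>A\<close> the component of \<open>y\<close> is already 0 and stays
    so.\<close>
  have Pz: "?P k *v z = ((k $ l - h $ l) / (g $ l - h $ l)) *\<^sub>R (?P k *v y)" for k
    by (simp add: z_def matrix_vector_mult_scaleR matrix_vector_mult_diff_distrib
        spectral_projection_shift[OF diag] flip: scaleR_left_diff_distrib)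
  have "z \<in> U"
    unfolding z_def using U inv y(1)
    by (intro subspace_scale subspace_diff) (auto simp: shift_invariant_def)
  with y l show ?case by (intro bexI[of _ z]) (auto simp: Pz)
qed

lemma shift_invariant_spectral_projection:
  assumes "joint_diagonalization S Q lam" "shift_invariant S U" "subspace U" "x \<in> U"
    and "g \<in> range lam"
  shows "spectral_projection Q lam g *v x \<in> U"
proof -
  let ?P = "spectral_projection Q lam"
  obtain y where y: "y \<in> U" "?P g *v y = ?P g *v x" "\<forall>h\<in>range lam - {g}. ?P h *v y = 0"
    using shift_invariant_annihilate_components[OF assms(1-4), of "range lam - {g}" g] by auto
  \<comment> \<open>All components of \<open>y\<close> except the one at \<open>g\<close> vanish, so
    \<open>y\<close> itself is the wanted projection of \<open>x\<close>.\<close>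
  have "y = (\<Sum>h\<in>range lam. ?P h *v y)"
    using assms(1) by (simp add: sum_spectral_projection joint_diagonalization_def)
  also have "\<dots> = ?P g *v y"
    using y(3) assms(5) by (subst sum.remove[of _ g]) auto
  finally show ?thesis using y by simp
qed

theorem theorem3p3:
  fixes E :: "('n::finite \<times> 'n) set"
    and S :: "'d::finite \<Rightarrow> real^'n^'n"
    and Q :: "real^'n^'n"
    and lam :: "'n \<Rightarrow> real^'d"
    and M :: nat
    and \<gamma> :: "nat \<Rightarrow> real^'d"
    and U :: "(real^'n) set"
  assumes "CARD('n) \<ge> 2"
    and "simple_graph E"
    and "commuting_shifts E S"
    and "joint_diagonalization S Q lam"
    and "bij_betw \<gamma> {1..M} (range lam)"
    and "subspace U"
  shows "shift_invariant S U \<longleftrightarrow>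
    (\<exists>J :: real^'d \<Rightarrow> (real^'n) set. graph_range_function M \<gamma> J \<and>
      U = {x. \<forall>m\<in>{1..M}. graph_fourier Q lam \<gamma> x m \<in> J (\<gamma> m)})"
proof -
  let ?P = "spectral_projection Q lam"
  note diag = \<open>joint_diagonalization S Q lam\<close>
  have ran: "\<gamma> ` {1..M} = range lam"
    using assms(5) by (simp add: bij_betw_def)
  \<comment> \<open>The claim is first proved with joint eigenvalues as indices; the enumeration
    \<open>\<gamma>\<close> enters only through its image.\<close>
  have "shift_invariant S U \<longleftrightarrow>
    (\<exists>J. (\<forall>g\<in>range lam. subspace (J g)) \<and> U = {x. \<forall>g\<in>range lam. ?P g *v x \<in> J g})"
    (is "_ \<longleftrightarrow> ?R")
  proof
    assume inv: "shift_invariant S U"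
    \<comment> \<open>The signal \<open>u\<close> matching \<open>x\<close> at \<open>g\<close> may
      vary with \<open>g\<close>, so each component is placed in \<open>U\<close> separately before
      summing.\<close>
    have "x \<in> U" if "\<forall>g\<in>range lam. ?P g *v x \<in> (*v) (?P g) ` U" for x
    proof -
      have "?P g *v x \<in> U" if g: "g \<in> range lam" for g
      proof -
        obtain u where "u \<in> U" "?P g *v x = ?P g *v u"
          using \<open>\<forall>g\<in>range lam. _\<close> g by blast
        with g show ?thesis
          using shift_invariant_spectral_projection[OF diag inv \<open>subspace U\<close>] by simp
      qed
      then have "(\<Sum>g\<in>range lam. ?P g *v x) \<in> U"
        by (intro subspace_sum \<open>subspace U\<close>) auto
      with diag show ?thesis by (simp add: sum_spectral_projection joint_diagonalization_def)
    qed
    then have "U = {x. \<forall>g\<in>range lam. ?P g *v x \<in> (*v) (?P g) ` U}" by blast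
    moreover have "subspace ((*v) (?P g) ` U)" for g
      using \<open>subspace U\<close> by (intro linear_subspace_image) auto
    ultimately show ?R by (intro exI[of _ "\<lambda>g. (*v) (?P g) ` U"]) simp
  next
    assume ?R
    then show "shift_invariant S U"
      \<comment> \<open>A shift only rescales the component at \<open>g\<close>, and
        \<open>J g\<close> is closed under scaling.\<close>
      by (auto simp: shift_invariant_def spectral_projection_shift[OF diag] subspace_scale)
  qed
  then show ?thesis
    by (simp only: graph_range_function_def graph_fourier_def ran[symmetric] ball_simps(9))
qed

end
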